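(* The largest integer that is not $6$-representable is $15707$. That is, $15707$ is not $6$-representable, and every integer $m>15707$ is $6$-representable.
   Context: An integer $m$ is $6$-representable if there is a finite set $X$ of distinct positive integers with $\min X \geq 6$, $\sum_{x\in X}\frac1x = 1$ and $\sum_{x\in X} x^2 = m$. *)

theory Defs
  imports Complex_Main
begin

text \<open>
  The empty set, for which \<open>Min\<close> is unspecified, is excluded by the condition that the
  reciprocals sum to 1.
\<close>

definition representable :: "nat \<Rightarrow> int \<Rightarrow> bool" where
  "representable k m \<longleftrightarrow>
     (\<exists>X :: nat set. finite X \<and> (\<forall>x\<in>X. 0 < x) \<and> Min X \<ge> k \<and>
        (\<Sum>x\<in>X. 1 / (of_nat x :: rat)) = 1 \<and>
        (\<Sum>x\<in>X. (int x)^2) = m)"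

end

theory Submission
  imports Defs
begin

text \<open>
  \<^bold>\<open>Large values.\<close> If \<open>X\<close> represents \<open>m\<close> and \<open>S\<close> has reciprocal sum \<open>1/2\<close>, all elements
  at least \<open>6\<close> and no even element above \<open>10\<close>, then \<open>2X \<union> S\<close> represents \<open>4m + \<sigma>(S)\<close>, where
  \<open>\<sigma>\<close> is the sum of squares. Four such \<open>S\<close> whose \<open>\<sigma>(S)\<close> exhaust the residues modulo \<open>4\<close>
  reduce all \<open>m > 15707\<close> to \<open>15707 < m \<le> 4 \<cdot> 15707 + 13946\<close>. These are covered by unions
  \<open>A \<union> B\<close>, where \<open>B\<close> consists of \<open>3\<close>-smooth numbers, \<open>A\<close> of multiples of primes \<open>5 \<le> p \<le> 13\<close>,
  and the reciprocal sums of \<open>A\<close> and \<open>B\<close> are complementary: every pair of a list of \<open>A\<close>s and a list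
  of \<open>B\<close>s for the same splitting of \<open>1\<close> gives a representation.

  \<^bold>\<open>The exception.\<close> A representation of \<open>15707\<close> uses numbers between \<open>6\<close> and \<open>125\<close> only. A
  search decides them one by one, in an order in which the remaining
  reciprocals soon lose a prime factor from their denominators, or the remaining squares become
  divisible by \<open>4\<close>; every such moment is a divisibility test that prunes most partial solutions.
\<close>

section \<open>Subset sums of reciprocals and squares\<close>

text \<open>Reciprocals are scaled by a common multiple \<open>L\<close> of the denominators.\<close>

fun weights :: "nat \<Rightarrow> nat list \<Rightarrow> (num \<times> num) list" where
  "weights L [] = []"
| "weights L (x # xs) = (num_of_nat (L div x), num_of_nat (x * x)) # weights L xs"

text \<open>Pairs of a scaled reciprocal sum and a sum of squares. Entries have type
  \<open>num\<close>, which makes them positive and keeps evaluation on binary numerals; the sums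
  are natural numbers because the empty choice gives 0.\<close>

fun subset_sums :: "(num \<times> num) list \<Rightarrow> (nat \<times> nat) set" where
  "subset_sums [] = {(0, 0)}"
| "subset_sums ((w, q) # ps) =
     subset_sums ps \<union> (\<lambda>(a, b). (nat_of_num w + a, nat_of_num q + b)) ` subset_sums ps"

text \<open>This direction serves the impossibility proof: every set within the list is seen by the
  search.\<close>

lemma subset_sums_weights:
  assumes "\<forall>x\<in>set xs. 0 < x \<and> x dvd L" "0 < L" "X \<subseteq> set xs"
  shows "((\<Sum>x\<in>X. L div x), (\<Sum>x\<in>X. x * x)) \<in> subset_sums (weights L xs)"
  using assms
proof (induction xs arbitrary: X)
  case (Cons x xs)
  have pos: "0 < x" "0 < L div x"
    using Cons.prems(1,2) by (auto simp: dvd_div_eq_0_iff)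
  have fin: "finite X"
    using Cons.prems(3) finite_subset by blast
  show ?case
  proof (cases "x \<in> X")
    case True
    have "((\<Sum>y\<in>X - {x}. L div y), (\<Sum>y\<in>X - {x}. y * y)) \<in> subset_sums (weights L xs)"
      using Cons by (intro Cons.IH) auto
    moreover have "(\<Sum>y\<in>X. L div y) = L div x + (\<Sum>y\<in>X - {x}. L div y)"
      "(\<Sum>y\<in>X. y * y) = x * x + (\<Sum>y\<in>X - {x}. y * y)"
      using True fin by (simp_all add: sum.remove)
    ultimately show ?thesis
      using pos by (force simp: num_of_nat_inverse)
  next
    case False
    then show ?thesis
      using Cons by auto
  qed
qed auto

text \<open>This direction serves the constructions. Distinctness makes a choice of list positions a
  set with the same sums.\<close>

lemma subset_sums_weightsE:
  assumes "\<forall>x\<in>set xs. 0 < x \<and> x dvd L" "0 < L" "distinct xs" "(a, b) \<in> subset_sums (weights L xs)"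
  obtains X where "X \<subseteq> set xs" "(\<Sum>x\<in>X. L div x) = a" "(\<Sum>x\<in>X. x * x) = b"
  using assms
proof (induction xs arbitrary: a b thesis)
  case (Cons x xs)
  have pos: "0 < x" "0 < L div x"
    using Cons.prems(2,3) by (auto simp: dvd_div_eq_0_iff)
  consider "(a, b) \<in> subset_sums (weights L xs)"
    | a' b' where "(a', b') \<in> subset_sums (weights L xs)" "a = L div x + a'" "b = x * x + b'"
    using Cons.prems(5) pos by (auto simp: num_of_nat_inverse)
  then show ?case
  proof cases
    case 1
    show ?thesis
      by (rule Cons.IH[OF _ _ _ _ 1]) (use Cons.prems in auto)
  next
    case 2
    show ?thesis
    proof (rule Cons.IH[OF _ _ _ _ 2(1)])
      fix X assume X: "X \<subseteq> set xs" "(\<Sum>x\<in>X. L div x) = a'" "(\<Sum>x\<in>X. x * x) = b'"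
      have "finite X" "x \<notin> X"
        using X(1) Cons.prems(4) finite_subset by auto
      then show thesis
        using X 2 Cons.prems(1)[of "insert x X"] by auto
    qed (use Cons.prems in auto)
  qed
qed auto

lemma subset_sums_append:
  "(a, b) \<in> subset_sums ps \<Longrightarrow> (c, d) \<in> subset_sums qs \<Longrightarrow>
   (a + c, b + d) \<in> subset_sums (ps @ qs)"
  by (induction ps arbitrary: a b rule: subset_sums.induct) (force simp: add.assoc)+

lemma weights_append: "weights L (xs @ ys) = weights L xs @ weights L ys"
  by (induction xs) auto

section \<open>Representability in terms of subset sums\<close>

lemma representable_iff:
  "representable k m \<longleftrightarrow> (\<exists>X. finite X \<and> (\<forall>x\<in>X. 0 < x \<and> k \<le> x) \<and>
     (\<Sum>x\<in>X. 1 / rat_of_nat x) = 1 \<and> (\<Sum>x\<in>X. (int x)\<^sup>2) = m)"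
proof -
  have "(Min X \<ge> k) = (\<forall>x\<in>X. k \<le> x)"
    if "finite X" "(\<Sum>x\<in>X. 1 / rat_of_nat x) = 1" for X
  proof -
    \<comment> \<open>The empty set has reciprocal sum 0, so \<open>Min X\<close> is a genuine
      minimum here.\<close>
    have "X \<noteq> {}"
      using that(2) by auto
    then show ?thesis
      using that(1) by simp
  qed
  then show ?thesis
    unfolding representable_def by (metis (no_types, lifting))
qed

lemma sum_reciprocals_iff:
  assumes "\<forall>x\<in>X. 0 < x \<and> x dvd L" "0 < L"
  shows "(\<Sum>x\<in>X. 1 / rat_of_nat x) = 1 \<longleftrightarrow> (\<Sum>x\<in>X. L div x) = L"
proof -
  have "rat_of_nat (\<Sum>x\<in>X. L div x) = (\<Sum>x\<in>X. of_nat L * (1 / rat_of_nat x))"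
    unfolding of_nat_sum
  proof (rule sum.cong)
    fix x assume "x \<in> X"
    then obtain k where "L = x * k" "0 < x"
      using assms by auto
    then show "rat_of_nat (L div x) = of_nat L * (1 / rat_of_nat x)"
      by simp
  qed simp
  then have "rat_of_nat (\<Sum>x\<in>X. L div x) = of_nat L * (\<Sum>x\<in>X. 1 / rat_of_nat x)"
    by (simp add: sum_distrib_left)
  then have "(\<Sum>x\<in>X. 1 / rat_of_nat x) = 1 \<longleftrightarrow> rat_of_nat (\<Sum>x\<in>X. L div x) = rat_of_nat L"
    using assms(2) by auto
  then show ?thesis
    by (simp only: of_nat_eq_iff)
qed

lemma representable_of_subset_sums:
  assumes "\<forall>x\<in>set xs. 0 < x \<and> k \<le> x \<and> x dvd L" "0 < L" "distinct xs" "(L, n) \<in> subset_sums (weights L xs)"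
  shows "representable k (int n)"
proof -
  obtain X where X: "X \<subseteq> set xs" "(\<Sum>x\<in>X. L div x) = L" "(\<Sum>x\<in>X. x * x) = n"
    using assms by (elim subset_sums_weightsE[rotated 3]) auto
  moreover have "(\<Sum>x\<in>X. (int x)\<^sup>2) = int n"
    unfolding X(3)[symmetric] by (simp add: power2_eq_square)
  moreover have "(\<Sum>x\<in>X. 1 / rat_of_nat x) = 1"
    using X assms by (subst sum_reciprocals_iff) auto
  ultimately show ?thesis
    unfolding representable_iff using assms(1) finite_subset[OF X(1)] by auto
qed

section \<open>The search for a representation\<close>

datatype sdiff = Neg | Zero | Pos num

text \<open>For a difference d, the next three functions give 2d, 2d + 1 and 2d - 1, with all
  negative values merged into \<open>Neg\<close>. This is consistent: d \<le> -1 implies 2d + 1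
  \<le> -1.\<close>

fun pos_dbl :: "sdiff \<Rightarrow> sdiff" where
  "pos_dbl (Pos n) = Pos (num.Bit0 n)"
| "pos_dbl d = d"

fun pos_inc :: "sdiff \<Rightarrow> sdiff" where
  "pos_inc (Pos n) = Pos (num.Bit1 n)"
| "pos_inc Zero = Pos num.One"
| "pos_inc Neg = Neg"

fun pos_dec :: "sdiff \<Rightarrow> sdiff" where
  "pos_dec (Pos n) = Pos (Num.BitM n)"
| "pos_dec d = Neg"

fun diff :: "num \<Rightarrow> num \<Rightarrow> sdiff" where
  "diff num.One num.One = Zero"
| "diff num.One (num.Bit0 n) = Neg"
| "diff num.One (num.Bit1 n) = Neg"
| "diff (num.Bit0 m) num.One = Pos (Num.BitM m)"
| "diff (num.Bit1 m) num.One = Pos (num.Bit0 m)"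
| "diff (num.Bit0 m) (num.Bit0 n) = pos_dbl (diff m n)"
| "diff (num.Bit1 m) (num.Bit1 n) = pos_dbl (diff m n)"
| "diff (num.Bit1 m) (num.Bit0 n) = pos_inc (diff m n)"
| "diff (num.Bit0 m) (num.Bit1 n) = pos_dec (diff m n)"

lemma Suc_nat_of_BitM: "Suc (nat_of_num (Num.BitM n)) = 2 * nat_of_num n"
  by (induction n) auto

lemma diff_cases:
  "case diff m n of
     Neg \<Rightarrow> nat_of_num m < nat_of_num n
   | Zero \<Rightarrow> nat_of_num m = nat_of_num n
   | Pos r \<Rightarrow> nat_of_num m = nat_of_num n + nat_of_num r"
proof (induction m n rule: diff.induct)
  case (2 n) then show ?case using nat_of_num_pos[of n] by simp
next
  case (3 n) then show ?case using nat_of_num_pos[of n] by simp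
next
  case (4 m) then show ?case using Suc_nat_of_BitM[of m] by simp
next
  case (6 m n) then show ?case by (cases "diff m n") auto
next
  case (7 m n) then show ?case by (cases "diff m n") auto
next
  case (8 m n) then show ?case by (cases "diff m n") auto
next
  case (9 m n)
  show ?case
  proof (cases "diff m n")
    case (Pos r) then show ?thesis using 9 Suc_nat_of_BitM[of r] by simp
  qed (use 9 in auto)
qed auto

lemma nat_of_num_neq_0: "nat_of_num n \<noteq> 0"
  by (simp add: nat_of_num_pos)

lemma diff_less: "diff m n = Pos r \<Longrightarrow> nat_of_num r < nat_of_num m"
  using diff_cases[of m n] nat_of_num_pos[of n] by simp

lemma diff_eq_Pos: "nat_of_num m = nat_of_num n + nat_of_num r \<Longrightarrow> diff m n = Pos r"
  using diff_cases[of m n] nat_of_num_pos[of r] by (auto split: sdiff.splits simp: num_eq_iff)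

lemma diff_self: "diff n n = Zero"
  using diff_cases[of n n] by (auto split: sdiff.splits simp: nat_of_num_neq_0)

text \<open>Exact division by the odd number \<open>2 * k + 1\<close>, with junk results when the division is not exact.\<close>

function div_odd :: "num \<Rightarrow> num \<Rightarrow> sdiff" where
  "div_odd k num.One = Neg"
| "div_odd k (num.Bit0 n) = pos_dbl (div_odd k n)"
| "div_odd k (num.Bit1 n) =
     (case diff n k of Neg \<Rightarrow> Neg | Zero \<Rightarrow> Pos num.One | Pos m \<Rightarrow> pos_inc (div_odd k m))"
  by pat_completeness auto
termination
  by (relation "measure (\<lambda>(k, n). nat_of_num n)") (auto simp: nat_of_num_pos dest: diff_less)

text \<open>Division runs from the low-order bit. An even quotient passes on its zero bit; for an
  odd one, (2k + 1)(2r + 1) = 2(k + (2k + 1)r) + 1, so subtracting k from the upper bits leaves (2k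
  + 1)r. Exact products are the only case that soundness of the search depends on.\<close>

lemma div_odd_mult: "div_odd k (num.Bit1 k * r) = Pos r"
proof (induction r)
  case (Bit1 r)
  have eq: "num.Bit1 k * num.Bit1 r = num.Bit1 (k + num.Bit1 k * r)"
    by (simp add: num_eq_iff nat_of_num_add nat_of_num_mult algebra_simps)
  have "diff (k + num.Bit1 k * r) k = Pos (num.Bit1 k * r)"
    by (rule diff_eq_Pos) (simp add: nat_of_num_add)
  then show ?case
    unfolding eq using Bit1 by simp
qed (simp_all add: diff_self)

fun half :: "num \<Rightarrow> sdiff" where
  "half (num.Bit0 n) = Pos n"
| "half (num.Bit1 n) = Neg"
| "half num.One = Neg"

fun quarter :: "num \<Rightarrow> sdiff" where
  "quarter (num.Bit0 n) = half n"
| "quarter (num.Bit1 n) = Neg"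
| "quarter num.One = Neg"

text \<open>
  \<open>Take w q\<close> decides about an element of weight \<open>w\<close> and square \<open>q\<close>. The other steps record that all
  later weights are divisible by \<open>2\<close> or by \<open>2 * k + 1\<close>, or all later squares by \<open>4\<close>; from there on
  they are measured in that larger unit.
\<close>

datatype step = Take num num | Half | Odd num | Quarter

fun unscale :: "step list \<Rightarrow> (num \<times> num) list" where
  "unscale [] = []"
| "unscale (Take w q # ss) = (w, q) # unscale ss"
| "unscale (Half # ss) = map (\<lambda>(w, q). (num.Bit0 w, q)) (unscale ss)"
| "unscale (Odd k # ss) = map (\<lambda>(w, q). (num.Bit1 k * w, q)) (unscale ss)"
| "unscale (Quarter # ss) = map (\<lambda>(w, q). (w, num.Bit0 (num.Bit0 q))) (unscale ss)"

text \<open>Continues with what is left of the two targets. \<open>Neg\<close> means that a target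
  was overshot or is not divisible. Two zeros mean that both targets were met, so the claim of
  unreachability fails. A single zero is a dead end, since every further element increases both
  sums.\<close>

fun resume :: "(num \<Rightarrow> num \<Rightarrow> bool) \<Rightarrow> sdiff \<Rightarrow> sdiff \<Rightarrow> bool" where
  "resume f (Pos R) (Pos S) = f R S"
| "resume f Zero Zero = False"
| "resume f Zero (Pos S) = True"
| "resume f (Pos R) Zero = True"
| "resume f Neg e = True"
| "resume f Zero Neg = True"
| "resume f (Pos R) Neg = True"

text \<open>An exhaustive search over both choices for each element. With no steps left the answer
  is \<open>True\<close> because the targets, being of type \<open>num\<close>, are still
  positive.\<close>

fun unreachable :: "step list \<Rightarrow> num \<Rightarrow> num \<Rightarrow> bool" where
  "unreachable [] R S = True"
| "unreachable (Take w q # ss) R S =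
     (unreachable ss R S \<and> resume (unreachable ss) (diff R w) (diff S q))"
| "unreachable (Half # ss) R S = resume (unreachable ss) (half R) (Pos S)"
| "unreachable (Odd k # ss) R S = resume (unreachable ss) (div_odd k R) (Pos S)"
| "unreachable (Quarter # ss) R S = resume (unreachable ss) (Pos R) (quarter S)"

section \<open>Soundness of the search\<close>

lemma subset_sums_eq_0: "(a, b) \<in> subset_sums ps \<Longrightarrow> a = 0 \<longleftrightarrow> b = 0"
proof (induction ps arbitrary: a b rule: subset_sums.induct)
  case (2 w q ps)
  then show ?case
    by (auto simp: nat_of_num_neq_0)
qed simp

lemma subset_sums_map:
  assumes "\<And>w. nat_of_num (f w) = c * nat_of_num w" "\<And>q. nat_of_num (g q) = d * nat_of_num q"
  shows "subset_sums (map (\<lambda>(w, q). (f w, g q)) ps) = (\<lambda>(a, b). (c * a, d * b)) ` subset_sums ps"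
proof (induction ps rule: subset_sums.induct)
  case (2 w q ps)
  then show ?case
    by (auto simp: assms image_Un image_image case_prod_beta algebra_simps)
qed auto

lemma num_exhaust_nat: obtains "k = 0" | n where "k = nat_of_num n"
  by (metis num_of_nat_inverse gr0I)

text \<open>At a change of unit, every sum of the remaining elements is a multiple of the factor. A
  reachable target therefore divides exactly, and the quotient is reachable in the new unit.\<close>

lemma unreachable_sound:
  "unreachable ss R S \<Longrightarrow> (nat_of_num R, nat_of_num S) \<notin> subset_sums (unscale ss)"
proof (induction ss arbitrary: R S)
  case Nil
  then show ?case by (simp add: nat_of_num_neq_0)
next
  case (Cons s ss)
  show ?case
  proof
    assume *: "(nat_of_num R, nat_of_num S) \<in> subset_sums (unscale (s # ss))"
    show False
    proof (cases s)
      case (Take w q)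
      then have "(nat_of_num R, nat_of_num S) \<notin> subset_sums (unscale ss)"
        using Cons by simp
      then obtain a b where ab: "(a, b) \<in> subset_sums (unscale ss)"
        "nat_of_num R = nat_of_num w + a" "nat_of_num S = nat_of_num q + b"
        using * Take by auto
      show False
      \<comment> \<open>If nothing remains in one coordinate, nothing remains in the other: the
        targets were met exactly, which \<open>resume\<close> reports as
        \<open>False\<close>.\<close>
      proof (cases "a = 0")
        case True
        then have "b = 0"
          using ab subset_sums_eq_0 by blast
        then have "R = w" "S = q"
          using ab True by (simp_all add: num_eq_iff)
        then show False
          using Cons.prems Take by (simp add: diff_self)
      next
        case False
        then have "b \<noteq> 0"
          using ab subset_sums_eq_0 by blast
        then obtain a' b' where a': "a = nat_of_num a'" "b = nat_of_num b'"
          using False by (metis num_exhaust_nat)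
        then have "diff R w = Pos a'" "diff S q = Pos b'"
          using ab by (simp_all add: diff_eq_Pos)
        then show False
          using Cons.prems Cons.IH[of a' b'] Take ab a' by simp
      qed
    next
      case Half
      then have "(nat_of_num R, nat_of_num S) \<in> (\<lambda>(a, b). (2 * a, 1 * b)) ` subset_sums (unscale ss)"
        using * by (subst subset_sums_map[symmetric, where f = num.Bit0 and g = id]) auto
      then obtain a where a: "nat_of_num R = 2 * a" "(a, nat_of_num S) \<in> subset_sums (unscale ss)"
        by auto
      then obtain a' where a': "a = nat_of_num a'"
        by (metis num_exhaust_nat nat_of_num_neq_0 mult_0_right)
      then have "R = num.Bit0 a'"
        using a by (simp add: num_eq_iff)
      then show False
        using Cons.prems Cons.IH[of a' S] Half a a' by simp
    next
      case (Odd k)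
      then have "(nat_of_num R, nat_of_num S) \<in>
          (\<lambda>(a, b). (nat_of_num (num.Bit1 k) * a, 1 * b)) ` subset_sums (unscale ss)"
        using * by (subst subset_sums_map[symmetric, where f = "(*) (num.Bit1 k)" and g = id])
          (auto simp del: mult_num_simps simp: nat_of_num_mult)
      then obtain a where a: "nat_of_num R = nat_of_num (num.Bit1 k) * a"
        "(a, nat_of_num S) \<in> subset_sums (unscale ss)"
        by auto
      then obtain a' where a': "a = nat_of_num a'"
        by (metis num_exhaust_nat nat_of_num_neq_0 mult_0_right)
      then have "R = num.Bit1 k * a'"
        using a by (simp add: num_eq_iff nat_of_num_mult)
      then show False
        using Cons.prems Cons.IH[of a' S] Odd a a' by (simp add: div_odd_mult)
    next
      case Quarter
      then have "(nat_of_num R, nat_of_num S) \<in> (\<lambda>(a, b). (1 * a, 4 * b)) ` subset_sums (unscale ss)"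
        using * by (subst subset_sums_map[symmetric, where f = id and g = "\<lambda>q. num.Bit0 (num.Bit0 q)"]) auto
      then obtain b where b: "nat_of_num S = 4 * b" "(nat_of_num R, b) \<in> subset_sums (unscale ss)"
        by auto
      then obtain b' where b': "b = nat_of_num b'"
        by (metis num_exhaust_nat nat_of_num_neq_0 mult_0_right)
      then have "S = num.Bit0 (num.Bit0 b')"
        using b by (simp add: num_eq_iff)
      then show False
        using Cons.prems Cons.IH[of R b'] Quarter b b' by simp
    qed
  qed
qed

section \<open>The number 15707\<close>

lemma num_of_nat_1: "num_of_nat 1 = num.One"
  by simp

text \<open>The multiples of each large prime stand together, largest primes first; after them that
  prime has left all remaining denominators. Top powers such as 121, 81, 49, 64 and 125 come early
  enough to lower the exponents of small primes. The last odd numbers precede a tail of even ones,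
  and later a tail of multiples of 4, 8 and 16, where \<open>Quarter\<close> applies.\<close>

definition order :: "nat list" where
  "order =
    [113, 109, 107, 103, 101, 97, 89, 83, 79, 73, 71, 67, 122, 61, 118, 59, 106, 53, 94, 47, 86,
     43, 123, 82, 41, 111, 74, 37, 124, 93, 62, 31, 116, 87, 58, 29, 115, 92, 69, 46, 23, 114,
     95, 76, 57, 38, 19, 119, 102, 85, 68, 51, 34, 17, 117, 104, 91, 78, 65, 52, 39, 26, 13,
     121, 110, 99, 88, 77, 66, 55, 44, 33, 22, 11, 81, 98, 49, 64, 125, 120, 96, 32, 108, 105,
     112, 100, 84, 70, 63, 56, 42, 35, 28, 21, 14, 7, 75, 50, 25, 54, 27, 45, 15, 9, 90, 80, 60,
     40, 30, 20, 10, 18, 6, 72, 36, 12, 16, 8, 24, 48]"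

abbreviation use :: "nat \<Rightarrow> nat \<Rightarrow> step" where
  "use w q \<equiv> Take (num_of_nat w) (num_of_nat q)"

abbreviation odd_factor :: "nat \<Rightarrow> step" where
  "odd_factor k \<equiv> Odd (num_of_nat k)"

text \<open>The numbers of \<open>order\<close> with the changes of unit inserted; weights and
  squares are in the units valid at that point. \<open>odd_factor k\<close> removes the prime 2k +
  1, so \<open>odd_factor 56\<close> belongs to 113. That the table is correct is checked by
  \<open>unscale_steps\<close>.\<close>

definition steps :: "step list" where
  "steps =
    [use  465255246707456329851708912425623181051455392936000 12769, odd_factor 56, use 
     4268396758784003026162467086473607165609682504000 11881, odd_factor 54, use 
     39891558493308439496845486789472964164576472000 11449, odd_factor 53, use 
     387296684401052810648985308635659846258024000 10609, odd_factor 51, use 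
     3834620637634186244049359491442176695624000 10201, odd_factor 50, use 
     39532171522001920041745974138579141192000 9409, odd_factor 48, use 
     444181702494403595974673866725608328000 7921, odd_factor 44, use 
     5351586777041007180417757430429016000 6889, odd_factor 41, use 
     67741604772670976967313385195304000 6241, odd_factor 39, use 
     927967188666725711881005276648000 5329, odd_factor 36, use  13069960403756700167338102488000
     5041, odd_factor 35, use  195074035876965674139374664000 4489, odd_factor 33, use 
     1598967507188243230650612000 14884, use  3197935014376486461301224000 3721, odd_factor 30, use 
     27101144189631241197468000 13924, use  54202288379262482394936000 3481, odd_factor 29, use 
     511342343200589456556000 11236, use  1022684686401178913112000 2809, odd_factor 26, use 
     10879624323416796948000 8836, use  21759248646833593896000 2209, odd_factor 23, use 
     253014519149227836000 7396, use  506029038298455672000 1849, odd_factor 21, use 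
     4114057221938664000 15129, use  6171085832907996000 6724, use  12342171665815992000 1681,
     odd_factor 20, use  111190735728072000 12321, use  166786103592108000 5476, use 
     333572207184216000 1369, odd_factor 18, use  2690098445034000 15376, use  3586797926712000
     8649, use  5380196890068000 3844, use  10760393780136000 961, odd_factor 15, use  92762015346000
     13456, use  123682687128000 7569, use  185524030692000 3364, use  371048061384000 841, odd_factor
     14, use  3226504881600 13225, use  4033131102000 8464, use  5377508136000 4761, use  8066262204000
     2116, use  16132524408000 529, odd_factor 11, use  141513372000 12996, use  169816046400 9025, use 
     212270058000 5776, use  283026744000 3249, use  424540116000 1444, use  849080232000 361,
     odd_factor 9, use  7135128000 14161, use  8324316000 10404, use  9989179200 7225, use  12486474000
     4624, use  16648632000 2601, use  24972948000 1156, use  49945896000 289, odd_factor 8, use 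
     426888000 13689, use  480249000 10816, use  548856000 8281, use  640332000 6084, use  768398400
     4225, use  960498000 2704, use  1280664000 1521, use  1920996000 676, use  3841992000 169,
     odd_factor 6, use  31752000 14641, odd_factor 5, use  3175200 12100, use  3528000 9801, use 
     3969000 7744, use  4536000 5929, use  5292000 4356, use  6350400 3025, use  7938000 1936, use 
     10584000 1089, use  15876000 484, use  31752000 121, odd_factor 5, use  392000 6561, odd_factor
     1, use  108000 9604, use  216000 2401, odd_factor 3, use  23625 4096, Half, use  6048 15625,
     odd_factor 2, use  1260 14400, use  1575 9216, use  4725 1024, Half, use  700 11664, use  720 11025,
     use  675 12544, use  756 10000, use  900 7056, use  1080 4900, use  1200 3969, use  1350 3136, use  1800
     1764, use  2160 1225, use  2700 784, use  3600 441, use  5400 196, use  10800 49, odd_factor 3, use 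
     144 5625, use  216 2500, use  432 625, odd_factor 2, use  40 2916, use  80 729, odd_factor 1, use  16
     2025, use  48 225, use  80 81, Quarter, use  8 2025, use  9 1600, use  12 900, use  18 400, use  24 225,
     use  36 100, use  72 25, odd_factor 2, use  8 81, use  24 9, Quarter, use  2 324, use  4 81, odd_factor
     1, use  4 9, Quarter, use  3 4, use  6 1, use  2 9, Quarter, use  1 9]"

schematic_goal steps_eq: "steps = ?ss"
  unfolding steps_def num_of_nat_numeral_eq num_of_nat_1 by (rule refl)

schematic_goal weights_order_eq: "weights 52573842877942565273243107104095419458814459401768000 order = ?ps"
  unfolding order_def by simp

lemma unscale_steps: "unscale steps = weights 52573842877942565273243107104095419458814459401768000 order"
  unfolding steps_eq weights_order_eq by code_simp

text \<open>The complete search for 15707. The first target is the reciprocal sum 1 in units of 1/L,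
  where L is this common multiple.\<close>

lemma unreachable_steps: "unreachable steps (num_of_nat 52573842877942565273243107104095419458814459401768000) (num_of_nat 15707)"
  unfolding steps_eq num_of_nat_numeral_eq by code_simp

lemma not_representable_15707: "\<not> representable 6 15707"
proof
  \<comment> \<open>\<open>?L\<close> is the least common multiple of 1, ..., 125.\<close>
  let ?L = "52573842877942565273243107104095419458814459401768000 :: nat"
  assume "representable 6 15707"
  then obtain X where X: "finite X" "\<forall>x\<in>X. 0 < x \<and> 6 \<le> x" "(\<Sum>x\<in>X. 1 / rat_of_nat x) = 1"
    "(\<Sum>x\<in>X. (int x)\<^sup>2) = 15707"
    unfolding representable_iff by blast
  have "int (\<Sum>x\<in>X. x * x) = 15707"
    using X(4) by (simp add: power2_eq_square)
  then have squares: "(\<Sum>x\<in>X. x * x) = 15707"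
    by linarith
  have "set [6..<126] \<subseteq> set order"
    by (simp add: order_def)
  moreover have "x \<in> set [6..<126]" if "x \<in> X" for x
  proof -
    have "x * x \<le> 15707"
      using member_le_sum[of x X "\<lambda>x. x * x"] that X(1) squares by simp
    \<comment> \<open>126 * 126 = 15876 already exceeds 15707.\<close>
    then have "x < 126"
      using mult_le_mono[of 126 x 126 x] by (cases "x < 126") auto
    then show ?thesis
      unfolding set_upt using X(2) that by auto
  qed
  ultimately have sub: "X \<subseteq> set order"
    by blast
  have dvd: "\<forall>x\<in>set order. 0 < x \<and> x dvd ?L"
    by (simp add: order_def)
  have "(\<Sum>x\<in>X. ?L div x) = ?L"
    using sum_reciprocals_iff[of X ?L] X(3) dvd sub by auto
  then have "(?L, 15707) \<in> subset_sums (unscale steps)"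
    using subset_sums_weights[OF dvd _ sub] squares by (simp add: unscale_steps)
  then show False
    using unreachable_sound[OF unreachable_steps] by (simp add: num_of_nat_inverse del: num_of_nat_numeral_eq)
qed

section \<open>Quadrupling\<close>

lemma representable_step:
  assumes "representable 6 m" "finite S" "\<forall>s\<in>S. 6 \<le> s \<and> (even s \<longrightarrow> s < 12)"
    "(\<Sum>s\<in>S. 1 / rat_of_nat s) = 1 / 2"
  shows "representable 6 (4 * m + (\<Sum>s\<in>S. (int s)\<^sup>2))"
proof -
  obtain X where X: "finite X" "\<forall>x\<in>X. 0 < x \<and> 6 \<le> x" "(\<Sum>x\<in>X. 1 / rat_of_nat x) = 1"
    "(\<Sum>x\<in>X. (int x)\<^sup>2) = m"
    using assms(1) by (auto simp: representable_iff)
  \<comment> \<open>Doubled elements are even and at least 12, while even elements of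
    \<open>S\<close> are below 12.\<close>
  have disj: "(*) 2 ` X \<inter> S = {}"
    using X(2) assms(3) by force
  have "(\<Sum>x\<in>(*) 2 ` X \<union> S. 1 / rat_of_nat x) = (\<Sum>x\<in>X. 1 / rat_of_nat x / 2) + 1 / 2"
    using X(1) assms(2,4) disj by (subst sum.union_disjoint) (auto simp: sum.reindex inj_on_def mult.commute)
  also have "\<dots> = 1"
    using X(3) by (simp only: sum_divide_distrib[symmetric])
  finally have recip: "(\<Sum>x\<in>(*) 2 ` X \<union> S. 1 / rat_of_nat x) = 1" .
  have "(\<Sum>x\<in>(*) 2 ` X \<union> S. (int x)\<^sup>2) = (\<Sum>x\<in>X. 4 * (int x)\<^sup>2) + (\<Sum>s\<in>S. (int s)\<^sup>2)"
    using X(1) assms(2) disj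
    by (subst sum.union_disjoint) (auto simp: sum.reindex inj_on_def power_mult_distrib)
  also have "\<dots> = 4 * m + (\<Sum>s\<in>S. (int s)\<^sup>2)"
    by (simp add: X(4) flip: sum_distrib_left)
  finally have squares: "(\<Sum>x\<in>(*) 2 ` X \<union> S. (int x)\<^sup>2) = 4 * m + (\<Sum>s\<in>S. (int s)\<^sup>2)" .
  show ?thesis
    unfolding representable_iff
    using X(1,2) assms(2,3) recip squares by (intro exI[of _ "(*) 2 ` X \<union> S"]) force
qed

text \<open>The constants are the sums of squares of the four sets in the proof, each with
  reciprocal sum 1/2. They are congruent to 0, 1, 2 and 3 modulo 4, in this order.\<close>

lemma representable_quadruple:
  assumes "representable 6 m" "c \<in> {13036, 13657, 13946, 12747}"
  shows "representable 6 (4 * m + c)"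
proof -
  consider "c = 13036" | "c = 13657" | "c = 13946" | "c = 12747"
    using assms(2) by auto
  then show ?thesis
  proof cases
    case 1 then show ?thesis
      using representable_step[OF assms(1), of "{10, 9, 11, 15, 21, 33, 45, 55, 77}"] by simp
  next
    case 2 then show ?thesis
      using representable_step[OF assms(1), of "{6, 7, 9, 21, 45, 105}"] by simp
  next
    case 3 then show ?thesis
      using representable_step[OF assms(1), of "{10, 7, 9, 15, 21, 45, 105}"] by simp
  next
    case 4 then show ?thesis
      using representable_step[OF assms(1), of "{6, 9, 11, 21, 33, 45, 55, 77}"] by simp
  qed
qed

lemma representable_above:
  assumes base: "\<And>m. m0 < m \<Longrightarrow> m \<le> 4 * m0 + 13946 \<Longrightarrow> representable 6 m" and "0 \<le> m0" "m0 < m"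
  shows "representable 6 m"
  using assms(3)
proof (induction "nat m" arbitrary: m rule: less_induct)
  case less
  show ?case
  proof (cases "m \<le> 4 * m0 + 13946")
    case False
    obtain c where c: "c \<in> {13036, 13657, 13946, 12747 :: int}" "4 dvd m - c"
    proof -
      have "4 dvd m - 13036 \<or> 4 dvd m - 13657 \<or> 4 dvd m - 13946 \<or> 4 dvd m - 12747"
        by presburger
      then show ?thesis
        using that by blast
    qed
    then obtain n where n: "m = 4 * n + c"
      by (metis diff_add_cancel dvdE)
    \<comment> \<open>Since 13946 is the largest constant, \<open>m\<close> > 4 * \<open>m0\<close>
      + 13946 forces \<open>n\<close> > \<open>m0\<close>; and \<open>n\<close> < \<open>m\<close>
      because \<open>c\<close> is positive.\<close>
    have "representable 6 n"
      using c(1) n False assms(2) by (intro less.hyps) auto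
    then show ?thesis
      unfolding n using c(1) by (rule representable_quadruple)
  qed (use base less.prems in auto)
qed

section \<open>Covering intervals by sumsets\<close>

text \<open>A tree of depth \<open>d\<close> is a set of residues modulo \<open>2 ^ d\<close>, indexed from the low-order bit.\<close>

datatype tree = Empty | Full | Node tree tree

fun blank :: "nat \<Rightarrow> tree" where
  "blank 0 = Empty"
| "blank (Suc d) = Node (blank d) (blank d)"

text \<open>The bits of the number guide the descent from the root, and those beyond the depth are
  ignored. A number whose bits run out before a leaf is not recorded.\<close>

fun mark :: "num \<Rightarrow> tree \<Rightarrow> tree" where
  "mark n Empty = Full"
| "mark n Full = Full"
| "mark num.One (Node l r) = Node l r"
| "mark (num.Bit0 n) (Node l r) = Node (mark n l) r"
| "mark (num.Bit1 n) (Node l r) = Node l (mark n r)"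

fun full :: "tree \<Rightarrow> bool" where
  "full Empty = False"
| "full Full = True"
| "full (Node l r) = (full l \<and> full r)"

text \<open>The invariant of marking: the tree is complete of depth \<open>d\<close>, and each full
  leaf has a witness for \<open>Q\<close> whose low bits lead there. Instead of storing the path,
  \<open>Q\<close> is pulled back along it.\<close>

fun marked_by :: "nat \<Rightarrow> (num \<Rightarrow> bool) \<Rightarrow> tree \<Rightarrow> bool" where
  "marked_by 0 Q t = (t = Empty \<or> t = Full \<and> (\<exists>n. Q n))"
| "marked_by (Suc d) Q t = (\<exists>l r. t = Node l r \<and>
     marked_by d (\<lambda>n. Q (num.Bit0 n)) l \<and> marked_by d (\<lambda>n. Q (num.Bit1 n)) r)"

lemma marked_by_blank: "marked_by d Q (blank d)"
  by (induction d arbitrary: Q) auto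

lemma marked_by_mark: "marked_by d Q t \<Longrightarrow> Q n \<Longrightarrow> marked_by d Q (mark n t)"
proof (induction n t arbitrary: d Q rule: mark.induct)
  case (1 n) then show ?case by (cases d) auto
next
  case (2 n) then show ?case by (cases d) auto
next
  case (3 l r) then show ?case by (cases d) auto
next
  case (4 n l r) then show ?case by (cases d) auto
next
  case (5 n l r) then show ?case by (cases d) auto
qed

text \<open>The bits of \<open>m\<close> lead to a leaf, whose witness has the same low bits. The
  bound 2 ^ d \<le> \<open>m\<close> ensures that \<open>m\<close> has enough bits for the
  descent.\<close>

lemma full_marked_by:
  "marked_by d Q t \<Longrightarrow> full t \<Longrightarrow> 2 ^ d \<le> nat_of_num m \<Longrightarrow>
   \<exists>n. Q n \<and> nat_of_num n mod 2 ^ d = nat_of_num m mod 2 ^ d"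
proof (induction d arbitrary: Q t m)
  case (Suc d)
  then obtain l r where lr: "t = Node l r" "marked_by d (\<lambda>n. Q (num.Bit0 n)) l"
    "marked_by d (\<lambda>n. Q (num.Bit1 n)) r" "full l" "full r"
    by auto
  \<comment> \<open>Restoring the lowest bit \<open>e\<close> turns a congruence modulo 2 ^ d into
    one modulo 2 ^ (d + 1).\<close>
  have step: "(2 * x + e) mod (2 * 2 ^ d) = 2 * (x mod 2 ^ d) + e" if "e < 2" for x e :: nat
    using that mod_mult2_eq[of "2 * x + e" 2 "2 ^ d"] by (simp add: div_add1_eq)
  show ?case
  proof (cases m)
    case One
    then have "2 * 2 ^ d \<le> (1 :: nat)"
      using Suc.prems(3) by simp
    moreover have "0 < (2 :: nat) ^ d"
      by simp
    ultimately show ?thesis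
      by linarith
  next
    case (Bit0 m')
    then obtain n where "Q (num.Bit0 n)" "nat_of_num n mod 2 ^ d = nat_of_num m' mod 2 ^ d"
      using Suc.IH[OF lr(2,4), of m'] Suc.prems(3) by auto
    then show ?thesis
      using Bit0 step[of 0 "nat_of_num n"] step[of 0 "nat_of_num m'"]
      by (intro exI[of _ "num.Bit0 n"]) (simp flip: mult_2)
  next
    case (Bit1 m')
    then obtain n where "Q (num.Bit1 n)" "nat_of_num n mod 2 ^ d = nat_of_num m' mod 2 ^ d"
      using Suc.IH[OF lr(3,5), of m'] Suc.prems(3) by auto
    then show ?thesis
      using Bit1 step[of 1 "nat_of_num n"] step[of 1 "nat_of_num m'"]
      by (intro exI[of _ "num.Bit1 n"]) (simp flip: mult_2)
  qed
qed auto

text \<open>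
  The auxiliary functions with a Boolean argument stand in for conditional expressions, whose
  branches would be rewritten anew after every decision. Going through the \<open>as\<close> in descending order,
  an element of \<open>bs\<close> that has become too small stays so.
\<close>

fun drop_low :: "num \<Rightarrow> num \<Rightarrow> num list \<Rightarrow> num list" and drop_low_if where
  "drop_low c a [] = []"
| "drop_low c a (b # bs) = drop_low_if (a + b < c) c a b bs"
| "drop_low_if True c a b bs = drop_low c a bs"
| "drop_low_if False c a b bs = b # bs"

fun sums_below :: "num \<Rightarrow> num \<Rightarrow> num list \<Rightarrow> num list" and sums_below_if where
  "sums_below e a [] = []"
| "sums_below e a (b # bs) = sums_below_if (a + b < e) e a (a + b) bs"
| "sums_below_if True e a s bs = s # sums_below e a bs"
| "sums_below_if False e a s bs = []"

fun sums_between :: "num \<Rightarrow> num \<Rightarrow> num list \<Rightarrow> num list \<Rightarrow> num list" and sums_from where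
  "sums_between c e [] bs = []"
| "sums_between c e (a # as) bs = sums_from c e a as (drop_low c a bs)"
| "sums_from c e a as bs = sums_below e a bs @ sums_between c e as bs"

text \<open>A lower and an upper bound, by which hopeless pairs of lists are skipped, and the list.\<close>

type_synonym block = "num \<times> num \<times> num list"

fun block_sums :: "num \<Rightarrow> num \<Rightarrow> block \<Rightarrow> block \<Rightarrow> num list" and block_sums_if where
  "block_sums c e (l, h, as) (l', h', bs) = block_sums_if (l + l' < e \<and> c \<le> h + h') c e as bs"
| "block_sums_if True c e as bs = sums_between c e as bs"
| "block_sums_if False c e as bs = []"

fun mark_all :: "num list \<Rightarrow> tree \<Rightarrow> tree" where
  "mark_all [] t = t"
| "mark_all (n # ns) t = mark_all ns (mark n t)"

fun mark_row :: "num \<Rightarrow> num \<Rightarrow> block \<Rightarrow> block list \<Rightarrow> tree \<Rightarrow> tree" where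
  "mark_row c e A [] t = t"
| "mark_row c e A (B # Bs) t = mark_row c e A Bs (mark_all (block_sums c e A B) t)"

fun mark_rows :: "num \<Rightarrow> num \<Rightarrow> block list \<Rightarrow> block list \<Rightarrow> tree \<Rightarrow> tree" where
  "mark_rows c e [] Bs t = t"
| "mark_rows c e (A # As) Bs t = mark_rows c e As Bs (mark_row c e A Bs t)"

fun mark_groups :: "num \<Rightarrow> num \<Rightarrow> (block list \<times> block list) list \<Rightarrow> tree \<Rightarrow> tree" where
  "mark_groups c e [] t = t"
| "mark_groups c e ((As, Bs) # gs) t = mark_groups c e gs (mark_rows c e As Bs t)"

text \<open>Each \<open>c\<close> starts a window of \<open>w\<close> consecutive numbers with a
  fresh tree. For \<open>w\<close> = 2 ^ d the numbers of a window have distinct residues, so a full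
  tree means a fully covered window.\<close>

fun covers :: "tree \<Rightarrow> num \<Rightarrow> (block list \<times> block list) list \<Rightarrow> num list \<Rightarrow> bool" where
  "covers t w gs [] = True"
| "covers t w gs (c # cs) = (full (mark_groups c (c + w) gs t) \<and> covers t w gs cs)"

section \<open>Correctness of the interval cover\<close>

lemma drop_low_spec:
  assumes "sorted bs"
  shows "sorted (drop_low c a bs) \<and> set (drop_low c a bs) \<subseteq> set bs \<and> (\<forall>b\<in>set (drop_low c a bs). c \<le> a + b)"
  using assms
proof (induction bs)
  case (Cons b bs)
  show ?case
  proof (cases "a + b < c")
    case True
    then show ?thesis using Cons by auto
  next
    case False
    have "c \<le> a + b'" if "b' \<in> set (b # bs)" for b'
    proof -
      have "b \<le> b'"
        using Cons.prems that by auto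
      then show ?thesis
        using False by (simp add: less_num_def less_eq_num_def nat_of_num_add)
    qed
    then show ?thesis
      using False Cons.prems by simp
  qed
qed simp

lemma sums_below_spec: "set (sums_below e a bs) \<subseteq> {a + b | b. b \<in> set bs \<and> a + b < e}"
proof (induction bs)
  case (Cons b bs)
  then show ?case
    by (cases "a + b < e") auto
qed simp

text \<open>Inclusion suffices: every number marked is a true sum in the window, and a missed sum
  could only leave the tree not full.\<close>

lemma sums_between_spec:
  assumes "sorted bs"
  shows "set (sums_between c e as bs) \<subseteq>
    {a + b | a b. a \<in> set as \<and> b \<in> set bs \<and> c \<le> a + b \<and> a + b < e}"
  using assms
proof (induction as arbitrary: bs)
  case (Cons a as)
  note low = drop_low_spec[OF Cons.prems, of c a]
  show ?case
    using Cons.IH[of "drop_low c a bs"] sums_below_spec[of e a "drop_low c a bs"] low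
    by simp blast
qed simp

lemma marked_by_mark_all:
  "marked_by d Q t \<Longrightarrow> (\<And>n. n \<in> set ns \<Longrightarrow> Q n) \<Longrightarrow> marked_by d Q (mark_all ns t)"
  by (induction ns arbitrary: t) (auto simp: marked_by_mark)

text \<open>Sortedness of the second list is what lets \<open>drop_low\<close> stop at the first
  element that is large enough.\<close>

definition block_ok :: "(num \<Rightarrow> bool) \<Rightarrow> block \<Rightarrow> block \<Rightarrow> bool" where
  "block_ok P A B \<longleftrightarrow> sorted (snd (snd B)) \<and>
     (\<forall>a\<in>set (snd (snd A)). \<forall>b\<in>set (snd (snd B)). P (a + b))"

lemma block_sums_spec:
  assumes "block_ok P A B" "n \<in> set (block_sums c e A B)"
  shows "P n \<and> c \<le> n \<and> n < e"
proof -
  obtain l h as l' h' bs where AB: "A = (l, h, as)" "B = (l', h', bs)"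
    by (metis prod_cases3)
  have "n \<in> set (sums_between c e as bs)"
    using assms(2) unfolding AB by (cases "l + l' < e \<and> c \<le> h + h'") simp_all
  then show ?thesis
    using assms(1) sums_between_spec[of bs c e as] unfolding AB block_ok_def by auto
qed

lemma marked_by_mark_row:
  assumes "marked_by d (\<lambda>n. P n \<and> c \<le> n \<and> n < e) t" "\<forall>B\<in>set Bs. block_ok P A B"
  shows "marked_by d (\<lambda>n. P n \<and> c \<le> n \<and> n < e) (mark_row c e A Bs t)"
  using assms
proof (induction Bs arbitrary: t)
  case (Cons B Bs)
  then show ?case
    using block_sums_spec[of P A B _ c e] by (simp add: marked_by_mark_all)
qed simp

lemma marked_by_mark_rows:
  assumes "marked_by d (\<lambda>n. P n \<and> c \<le> n \<and> n < e) t"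
    "\<forall>A\<in>set As. \<forall>B\<in>set Bs. block_ok P A B"
  shows "marked_by d (\<lambda>n. P n \<and> c \<le> n \<and> n < e) (mark_rows c e As Bs t)"
  using assms by (induction As arbitrary: t) (simp_all add: marked_by_mark_row)

lemma marked_by_mark_groups:
  assumes "marked_by d (\<lambda>n. P n \<and> c \<le> n \<and> n < e) t"
    "\<forall>(As, Bs)\<in>set gs. \<forall>A\<in>set As. \<forall>B\<in>set Bs. block_ok P A B"
  shows "marked_by d (\<lambda>n. P n \<and> c \<le> n \<and> n < e) (mark_groups c e gs t)"
  using assms by (induction gs arbitrary: t) (auto simp add: marked_by_mark_rows)

text \<open>The full tree yields a witness \<open>n\<close> in the same window with \<open>n\<close>
  congruent to \<open>m\<close> modulo 2 ^ d. The two differ by less than 2 ^ d, hence are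
  equal.\<close>

lemma covers_imp:
  assumes "covers (blank d) w gs cs"
    "\<forall>(As, Bs)\<in>set gs. \<forall>A\<in>set As. \<forall>B\<in>set Bs. block_ok P A B"
    "c \<in> set cs" "nat_of_num w = 2 ^ d" "2 ^ d \<le> nat_of_num c" "c \<le> m" "m < c + w"
  shows "P m"
proof -
  have "full (mark_groups c (c + w) gs (blank d))"
    using assms(1,3) by (induction cs) auto
  moreover have "marked_by d (\<lambda>n. P n \<and> c \<le> n \<and> n < c + w) (mark_groups c (c + w) gs (blank d))"
    using assms(2) by (intro marked_by_mark_groups marked_by_blank)
  moreover have "2 ^ d \<le> nat_of_num m"
    using assms(5,6) by (simp add: less_eq_num_def)
  ultimately obtain n where n: "P n" "c \<le> n" "n < c + w"
    "nat_of_num n mod 2 ^ d = nat_of_num m mod 2 ^ d"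
    using full_marked_by by blast
  have "nat_of_num n < nat_of_num m + 2 ^ d" "nat_of_num m < nat_of_num n + 2 ^ d"
    using n(2,3) assms(4,6,7) by (simp_all add: less_num_def less_eq_num_def nat_of_num_add)
  then have "int (nat_of_num n) < int (nat_of_num m + 2 ^ d)"
    "int (nat_of_num m) < int (nat_of_num n + 2 ^ d)"
    by linarith+
  then have close: "\<bar>int (nat_of_num n) - int (nat_of_num m)\<bar> < 2 ^ d"
    by (simp add: abs_less_iff)
  have "int (nat_of_num n) mod 2 ^ d = int (nat_of_num m) mod 2 ^ d"
    using arg_cong[OF n(4), of int] by (simp add: of_nat_mod)
  then have "2 ^ d dvd int (nat_of_num n) - int (nat_of_num m)"
    by (simp add: mod_eq_dvd_iff)
  then have "int (nat_of_num n) - int (nat_of_num m) = 0"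
    using close zdvd_not_zless[of "\<bar>int (nat_of_num n) - int (nat_of_num m)\<bar>" "2 ^ d"] by auto
  then have "n = m"
    by (simp add: num_eq_iff)
  then show ?thesis
    using n(1) by simp
qed


section \<open>Sets encoded as bit masks\<close>

fun add_to :: "num \<times> num \<Rightarrow> (num \<times> num) option \<Rightarrow> (num \<times> num) option" where
  "add_to p None = None"
| "add_to (w, q) (Some (w', q')) = Some (w + w', q + q')"

text \<open>Bit i of the mask, counted from the low end, selects the i-th pair, and the leading bit
  selects the last one. A mask longer than the list gives \<open>None\<close>.\<close>

fun sum_mask :: "num \<Rightarrow> (num \<times> num) list \<Rightarrow> (num \<times> num) option" where
  "sum_mask n [] = None"
| "sum_mask num.One (p # ps) = Some p"
| "sum_mask (num.Bit0 n) (p # ps) = sum_mask n ps"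
| "sum_mask (num.Bit1 n) (p # ps) = add_to p (sum_mask n ps)"

lemma zero_in_subset_sums: "(0, 0) \<in> subset_sums ps"
  by (induction ps rule: subset_sums.induct) auto

lemma sum_mask_in_subset_sums:
  "sum_mask n ps = Some (w, q) \<Longrightarrow> (nat_of_num w, nat_of_num q) \<in> subset_sums ps"
proof (induction n ps arbitrary: w q rule: sum_mask.induct)
  case (2 p ps)
  then show ?case using zero_in_subset_sums[of ps] by (cases p) force
next
  case (3 n p ps)
  then show ?case by (cases p) auto
next
  case (4 n p ps)
  then obtain w' q' where "sum_mask n ps = Some (w', q')" "w = fst p + w'" "q = snd p + q'"
    by (cases p; cases "sum_mask n ps") auto
  then show ?case
    using 4(1)[of w' q'] by (cases p) (force simp: nat_of_num_add)
qed simp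

fun squares :: "(num \<times> num) list \<Rightarrow> num list \<Rightarrow> num list" and squares_of where
  "squares ps [] = []"
| "squares ps (n # ns) = squares_of ps ns (sum_mask n ps)"
| "squares_of ps ns None = squares ps ns"
| "squares_of ps ns (Some (w, q)) = q # squares ps ns"

fun weights_are :: "num \<Rightarrow> (num \<times> num) list \<Rightarrow> num list \<Rightarrow> bool" and weight_is where
  "weights_are r ps [] = True"
| "weights_are r ps (n # ns) = (weight_is r (sum_mask n ps) \<and> weights_are r ps ns)"
| "weight_is r None = False"
| "weight_is r (Some (w, q)) = (w = r)"

fun ascending :: "num list \<Rightarrow> block" where
  "ascending bs = (hd bs, last bs, bs)"

fun descending :: "num list \<Rightarrow> block" where
  "descending as = (last as, hd as, as)"

text \<open>The reciprocal sums of the two parts (times \<open>L\<close>) and the masks of the sets with these sums.\<close>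

type_synonym mask_group = "num \<times> num \<times> num list list \<times> num list list"

fun evaluate :: "(num \<times> num) list \<Rightarrow> (num \<times> num) list \<Rightarrow> mask_group list \<Rightarrow>
    (block list \<times> block list) list" where
  "evaluate ps qs [] = []"
| "evaluate ps qs ((r, s, As, Bs) # gs) =
     (map (\<lambda>ns. descending (squares ps ns)) As, map (\<lambda>ns. ascending (squares qs ns)) Bs) # evaluate ps qs gs"

fun valid :: "num \<Rightarrow> (num \<times> num) list \<Rightarrow> (num \<times> num) list \<Rightarrow> mask_group list \<Rightarrow> bool" where
  "valid L ps qs [] = True"
| "valid L ps qs ((r, s, As, Bs) # gs) = (r + s = L \<and>
     list_all (weights_are r ps) As \<and> list_all (weights_are s qs) Bs \<and>
     list_all (\<lambda>ns. sorted (squares qs ns)) Bs \<and> valid L ps qs gs)"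

lemma weights_areE:
  assumes "weights_are r ps ns" "q \<in> set (squares ps ns)"
  shows "(nat_of_num r, nat_of_num q) \<in> subset_sums ps"
  using assms
proof (induction ns)
  case (Cons n ns)
  then show ?case
    using sum_mask_in_subset_sums[of n ps] by (cases "sum_mask n ps") auto
qed simp

text \<open>Any \<open>A\<close> and any \<open>B\<close> of one group may be joined, since their
  scaled reciprocal sums \<open>r\<close> and \<open>s\<close> add up to \<open>L\<close>; the
  squares add as well.\<close>

lemma block_ok_evaluate:
  assumes "valid L ps qs gs"
  shows "\<forall>(As, Bs)\<in>set (evaluate ps qs gs). \<forall>A\<in>set As. \<forall>B\<in>set Bs.
    block_ok (\<lambda>n. (nat_of_num L, nat_of_num n) \<in> subset_sums (ps @ qs)) A B"
  using assms
proof (induction L ps qs gs rule: valid.induct)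
  case (2 L ps qs r s As Bs gs)
  have "block_ok (\<lambda>n. (nat_of_num L, nat_of_num n) \<in> subset_sums (ps @ qs))
      (descending (squares ps ns)) (ascending (squares qs ns'))"
    if "ns \<in> set As" "ns' \<in> set Bs" for ns ns'
    unfolding block_ok_def
  proof (intro conjI ballI)
    show "sorted (snd (snd (ascending (squares qs ns'))))"
      using 2(2) that by (auto simp: list_all_iff)
    fix a b
    assume "a \<in> set (snd (snd (descending (squares ps ns))))" "b \<in> set (snd (snd (ascending (squares qs ns'))))"
    then have "(nat_of_num r, nat_of_num a) \<in> subset_sums ps" "(nat_of_num s, nat_of_num b) \<in> subset_sums qs"
      using 2(2) that by (auto simp: list_all_iff intro: weights_areE)
    moreover have "nat_of_num L = nat_of_num r + nat_of_num s"
      using 2(2) by (auto simp: nat_of_num_add)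
    ultimately show "(nat_of_num L, nat_of_num (a + b)) \<in> subset_sums (ps @ qs)"
      by (simp add: subset_sums_append nat_of_num_add)
  qed
  then show ?case
    using 2 by simp
qed simp

section \<open>The base interval\<close>

text \<open>Every element has a prime factor between 5 and 13, which makes this pool disjoint from
  the 3-smooth \<open>pool_b\<close>. The least common multiple of both pools is 21621600 = 2^5 *
  3^3 * 5^2 * 7 * 11 * 13.\<close>

definition pool_a :: "nat list" where
  "pool_a = [7, 22, 33, 10, 14, 11, 15, 20, 28, 21, 30, 35, 42, 40, 26, 52, 45, 56, 39, 60, 44, 55, 63, 13, 70, 66, 65, 77, 84, 50, 75, 88, 104, 91, 78, 90, 25, 100, 105, 110, 99, 80, 120, 117, 132, 126]"

definition pool_b :: "nat list" where
  "pool_b = [9, 24, 36, 18, 12, 6, 54, 8, 48, 16, 72, 27, 32, 96, 144, 108, 216]"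

text \<open>One entry for each splitting of 1; the first joins reciprocal sums 7/12 and 5/12. The
  masks of a splitting are cut into short lists so that whole pairs of blocks can be skipped for a
  given window.\<close>

definition masks :: "(nat \<times> nat \<times> nat list list \<times> nat list list) list" where
  "masks =
    [
     (12612600, 9009000, [[206250761062, 25773264663, 8605901071, 549791082211, 308664473,
     206162416455, 34527720305, 17383451877, 34395602110, 3775935913, 4355813913, 34628557558,
     1632180791, 275150604919, 17524237009, 4571946945, 1646055322, 274913871294, 206295057589,
     4338514003, 38663185326, 292124905847, 274970231911, 2285166747, 274953983257,
     8796101883161, 558354172985, 4438651198, 285884057, 8766131681, 8734147175], [35970424558,
     4438773849, 4362214270, 8618280599, 274912650139, 211340774, 285663982, 152710809,
     206159099191, 8692973743, 206161891407, 4339037065, 184694073, 17263911783, 2148454813,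
     17383312124, 171062169, 8602756633, 4303912678, 2164919133, 4125646, 92469686, 140056958,
     2315265909, 17592187098347, 378587211, 172172601, 34360471095, 304400615, 17383310581,
     17256188790, 4362211647], [2284856219, 34435356609, 96586358, 17251258222, 360759975,
     206162100639, 34395458814, 92469720, 8733622654, 1615398375, 274881058207, 21872823,
     4398046525231, 92467830, 135719719, 274878053047, 36493095, 1099518968301, 92853543,
     273226585, 170924519, 8598501998, 36103670, 4304030153, 8657329831, 285742455, 303180123,
     34628240382, 271895631, 549772596921, 76215470], [24188495, 17382260799, 1627532505,
     76217176, 80332071, 135718078, 80334161, 1611066905, 136979452, 4303911065, 1613766551,
     211866213, 35059027, 2149901779, 17448382, 285352887, 1646267646, 152569207, 269273078,
     140580604, 20066199, 21179623, 21179239, 52744793, 17263774439, 2151755101, 8632961179,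
     7936207, 403705575, 135935193, 153099509, 153099125], [39175499, 135931134, 210815342,
     285739375, 34359946543, 20238023, 269101431, 137150709, 34360120367, 80332105, 7718551,
     1610931822, 136103889, 2149900699, 2147928733, 20238671, 4927975, 210814638, 269271998,
     17619255, 1613764495, 5098734, 34376582910, 1611449689, 20064143, 4710894, 8657323879,
     268887705, 110155587, 168304185, 549756125625, 152051609], [981182, 39917743, 39916414,
     168303081, 167916729, 20236943, 35270355, 136630780, 136102007, 206161576287, 272700391,
     17251255001, 4303905113, 170918975, 5096807, 36488537, 2149716443, 17617199, 8657322799,
     110154891, 35797246, 4303386505, 78697671, 39913847, 34750426, 35269275, 139527143,
     2148852025, 303043419, 35970001, 92328359], [4406583, 7411678, 7412623, 35965942,
     135411609, 35268299, 52432615, 92326390, 2148548529, 139528255, 1627395801, 51387803,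
     1613759903, 39913143, 206158954815, 268578231, 36183159, 168298481, 92327463, 19930583,
     135584409, 1627392687, 136456429, 1610754743, 268580975, 36183961, 35795319, 135580350,
     4303386713, 2149595355, 35439003, 4578407], [4303382654, 79806887, 2148017629, 111198617,
     978641, 78696591, 5097113, 8598362727, 274877912383, 34921683, 38866331, 21042919,
     52434649, 36180967, 136627261, 7409111, 549755820281, 76078289, 92329497, 152044023,
     3809999, 76074230, 36182079, 135578807, 92328393, 168297401, 4406617, 671734, 19929503,
     76073846, 135578423], [75690449, 135407727, 17246999727, 4790206, 135797465, 136840181,
     34359809839, 4402558, 17247001817, 2148546473, 35135259, 4576382, 17247001433, 4577327,
     17246997758, 3678039, 34747803, 4303381913, 39913177, 2148544504, 285215295, 206158436415,
     977561, 167780081, 3290583, 78692695, 1610752687, 268751705, 4792265, 3462927, 268748030,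
     79808025], [16923367, 34920603, 268747646, 8598360017, 4788206, 206158435439, 976585,
     51385947, 2148666041, 268576375, 3463383, 7408031, 4403895, 136840317, 2147498845,
     34745803, 1610620727, 21039870, 34919627, 76077209, 17092030, 1611137527, 2148665065,
     34919243, 76073150, 7407055, 135791863, 135791479, 17094199, 17246995831, 76076233,
     35791535], [1610924505, 4401895, 76075849, 454055, 38864475, 4790383, 669678, 135578841,
     3289503, 8598358135, 16921342, 3675983, 842478, 17092199, 36176375, 21037943, 268575295,
     19927647, 17307055, 3288607, 4572727, 17309145, 669111, 4571623, 35963353, 843545, 4403929,
     135790783, 1610618671, 34359805247, 839486], [1610620761, 17246994751, 4399870, 17307255,
     34744923, 452030, 1610616702, 1610619127, 16918319, 7406175, 75554705, 17094233, 4787673,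
     3458335, 135273079, 840551, 16918775, 75550646, 17090174, 454089, 17091119, 268441527,
     453175, 75553390, 8598356079, 35657519, 4785783, 4267879, 34914651, 452199, 35657975,
     4572761], [268439527, 34611155, 669145, 17306175, 76071257, 75552823, 665086, 136316733,
     666031, 839855, 841945, 75551847, 3671391, 1610617071, 837886, 135268279, 167773433,
     17304175, 75552649, 167773049, 666231, 135271023, 4267183, 16916719, 4265854, 75548590,
     4784703, 4266799, 75550680, 451119, 268441561], [453209, 1610614079, 268437502, 268438447,
     16784759, 34610075, 3152855, 35655919, 835959, 34609099, 75550767, 75552857, 146686,
     75548798, 146302, 136315133, 35652927, 268439679, 4263287, 3152991, 135268313, 317351,
     319441, 315382, 16783679, 16782703, 144759, 3150799, 75548057, 531383, 135266431, 317559],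
     [4262207, 318361, 530407, 4261231, 314302, 16780975, 16782071, 143031, 317385, 531519,
     313326, 34604507, 143679, 4260599, 312759, 529327, 141679, 531417, 315503, 527358, 140975,
     3146207, 143065, 525815, 312793, 524735, 7415, 7031, 6335, 5359, 4975, 383]], [[57, 178,
     155, 174, 809, 930, 907, 2161, 828, 2259, 926, 1185, 2157, 2278, 2255, 1075, 2913, 1204,
     3011, 1181, 1071, 2932, 1937, 2909, 3030, 1827, 1956, 3304, 1933], [1846, 3194, 1823, 3285,
     12464, 3175, 12441, 12331, 4056, 12460, 3946, 12350, 4037, 13216, 13193, 3927, 13106,
     13083, 14545, 14435, 13212, 13102, 14564, 33002, 14541, 13361, 14454, 32885, 13459],
     [14431, 15297, 32983, 13357, 15187, 13478, 33656, 13455, 15316, 14113, 33754, 15206, 33637,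
     14211, 15183, 33735, 14132, 15480, 14109, 34032, 14230, 15578, 34009, 15461, 33899, 15559,
     17064, 34028, 16232], [16954, 33918, 34784, 17045, 16330, 34761, 16935, 34674, 16213,
     34651, 16810, 34780, 34670, 16693, 19168, 19145, 16791, 45288, 19058, 19035, 45178, 45269,
     19164, 17961, 45159, 18082, 19054, 18793, 18059, 18914], [18891, 46040, 17980, 45930,
     17840, 18812, 18078, 46021, 17817, 18910, 17707, 45911, 20065, 17836, 46185, 20163, 17726,
     46306, 46283, 20084, 20061, 29240, 46204, 20182, 19921, 29338, 46302, 19811, 29221],
     [46960, 46937, 29319, 19940, 47058, 19917, 29096, 19830, 46956, 19807, 28986, 47054, 29077,
     31344, 28967, 31321, 31442, 49873, 49763, 30368, 31340, 30345, 49892, 31200, 31438, 30258,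
     49869, 31177, 30235], [49782, 31090, 49521, 49759, 31067, 30364, 49619, 30254, 31196,
     29993, 30114, 31086, 49517, 30091, 49638, 49615, 32449, 30012, 32339, 30110, 50808, 32468,
     50906, 32358, 50789, 32097, 32335, 50887, 32195, 50664], [32116, 50554, 32093, 32214,
     50645, 50535, 62049, 62147, 62068, 67760, 62045, 62166, 67737, 61905, 67627, 61795, 67756,
     61924, 61901, 67646, 61814, 68512, 61791, 68489, 68402, 68379, 63192, 68508, 63082],
     [68398, 63173, 68657, 63063, 68755, 62840, 62938, 68653, 62821, 68774, 68751, 62919, 69409,
     69507, 69428, 69405, 69526, 79913, 80034, 98465, 80011, 98355, 79932, 98484, 80030, 98461,
     80688, 98351, 80665], [80786, 99217, 99107, 80684, 99236, 100584, 80782, 99213, 99126,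
     100474, 81041, 99103, 80931, 100565, 100455, 81060, 99498, 81037, 80950, 99381, 80927,
     81793, 99479, 101317, 81683, 100152, 101207, 81812, 100250, 81702]]),
     (12912900, 8708700, [[34367525263, 8925835879, 17273038552, 4320878695, 2491534277,
     1778984881, 17382341031, 1645608083, 420555623, 1099783340525, 405352165, 2299599069,
     1099528851283, 10209049161, 2184564841, 4339614105, 17256263847, 549759036350, 25770008473,
     34439492568, 17263970215, 21483555646, 3758170069, 8866869961, 274881130911, 8796097258047,
     35184372623321, 211012681], [2165902953, 4306585550, 1645295499, 8657400510, 206161650975,
     4362145662, 51767002, 152125393, 269346863, 36163895, 274878292527, 1611338103, 271660887,
     3660702, 92401078, 1627588671, 206158633214, 136919669, 1040310, 136704557, 4303577767,
     2148913080, 92523345, 135991241, 17290998, 303116507, 3657159, 17247076121], [271657807,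
     210886809, 1611212782, 136517557, 36255863, 92399222, 35329435, 4303577801, 76269095,
     549756013177, 3872215, 17247073127, 8598433390, 36038782, 17247192623, 268640103,
     135652078, 2148080477, 2165377769, 17502007, 136396469, 3656279, 269036719, 35208347,
     206158627503, 75749622, 206158629593, 135466855, 167852785], [268639023, 268820734,
     136395117, 34992331, 1099511764443, 915239, 17502041, 76148937, 8598430767, 17500407,
     3654223, 1035721, 34989339, 135465775, 515958, 1034807, 35732279, 75747566, 1033831,
     17379759, 35849726, 916633, 17377790, 2147557277, 912190, 17378863, 1610689790,
     2148605113], [1610689406, 135347801, 915273, 135343742, 911214, 514878, 75627409, 3531039,
     75623350, 2148603753, 17162878, 513902, 75626433, 34805083, 4303439193, 1034841,
     1610809967, 910647, 35728638, 35728254, 75627545, 75623486, 268512231, 34683859, 75746001,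
     513335, 136389821, 268514367, 136389437], [728318, 34803355, 268632823, 35848815,
     167846137, 392814, 34683995, 268514265, 1610686783, 268510206, 16857463, 16976959,
     2148599161, 75621841, 510255, 35725631, 3225695, 390055, 392145, 16974767, 388086,
     16976857, 16854759, 511641, 725311, 605303, 606105, 392281], [75620761, 508647, 388222,
     204734, 16856793, 603111, 16852734, 16853679, 722607, 724697, 390089, 604223, 386030,
     34677211, 603247, 385463, 81719, 598519, 200111, 385497, 200311, 79663, 81753, 77694,
     80119, 199231, 198255, 78063, 75071]], [[161, 51, 180, 157, 47, 913, 803, 932, 2280, 909,
     822, 2170, 799, 2261, 2151, 1194, 3032, 1077, 2922, 1175, 3013, 1848, 2903, 1946, 1829,
     3177, 3298, 1927, 3275, 12337, 3196], [12435, 3294, 3952, 3929, 12333, 4050, 12454, 13089,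
     3948, 13187, 4046, 13108, 14456, 13085, 33008, 13206, 14554, 14437, 32875, 13480, 14535,
     33004, 13370, 15208, 32894, 13461, 33760, 15306, 13351, 33737, 15189, 33627], [14232,
     14122, 33756, 15584, 33646, 14213, 15561, 14103, 34003, 15580, 16937, 33901, 17058, 34022,
     16336, 17035, 33999, 16226, 34657, 16203, 16956, 34755, 16816, 16332, 17054, 16793, 34676,
     16222, 16683, 34653, 34774], [19041, 16812, 45161, 16702, 45282, 45259, 19060, 45180,
     19158, 17955, 18897, 45278, 18787, 45913, 18061, 18916, 46034, 17974, 18893, 17951, 18806,
     45932, 17811, 18783, 46030, 17830, 46289, 20184, 17807, 20074, 20165, 46308], [29321,
     46285, 20055, 46198, 29211, 19832, 46175, 47041, 19930, 29340, 19813, 46931, 29230, 28969,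
     19911, 29090, 29067, 46950, 46927, 31425, 28988, 31315, 29086, 49784, 31444, 30241, 49882,
     31334, 49765, 31073, 30339], [31311, 49863, 31171, 30260, 49640, 30237, 31092, 30358,
     49530, 30097, 31069, 31190, 29987, 49621, 49511, 30116, 30093, 32360, 30006, 50912, 29983,
     32458, 50889, 50802, 32341, 50779, 50908, 32216, 50798, 32106, 50537, 50658], [32197,
     50635, 32087, 50556, 50654, 62168, 62058, 62149, 67633, 62039, 67731, 61816, 61914, 67629,
     61797, 67750, 67727, 61895, 68385, 68483, 63088, 68404, 63065, 63186, 68381, 68502, 63084,
     68776, 62944, 63182, 62921], [68666, 62834, 68757, 62811, 68647, 62940, 62830, 69528,
     69418, 69509, 69399, 80017, 79907, 80036, 98474, 80013, 98357, 79903, 80769, 98455, 80659,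
     99128, 80788, 99226, 80678, 99109, 100457, 80655, 80952, 100476, 80933, 99371]]),
     (13513500, 8108100, [[17276708689, 6182424793, 206163015783, 42958291383, 139972470,
     25774196079, 1615716919, 1627839079, 2357254707, 212398693, 2165974889, 4398046828607,
     2165456489, 211346585, 206162700663, 210826791, 39398811, 269284569, 139538231, 172043385,
     268883198, 136111321, 135589358, 272828015, 8657332287, 8598891417, 343992367, 52440574,
     303171291, 92457937], [4303898878, 206158564783, 206158750169, 35976039, 51395931,
     17247010713, 2148849849, 76085870, 2148848873, 35143635, 3472279, 34359819327, 76084327,
     79816401, 34926554, 4303376374, 168305913, 20056015, 4582711, 3472415, 8598367031,
     167908217, 17223577, 21047223, 35142555, 35047115, 34928731, 3685335, 135401447, 17104217],
     [76203721, 4303379353, 17220583, 4303375294, 136330813, 4303378377, 36185407, 268972159,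
     17221695, 135800793, 35261147, 849831, 2148843897, 4580655, 167787129, 35788095,
     1610627047, 4582745, 4398455, 847862, 75681191, 206158439743, 17101495, 17220719,
     8598367449, 8598364975, 3588815, 38871771, 8598367065, 34923931], [1610628159, 969399,
     268451582, 3466711, 4303376495, 135798911, 4794687, 35665895, 75683225, 850841, 75560743,
     34359812543, 4793711, 4397375, 35667007, 75558774, 135280303, 135282393, 35785463,
     268449655, 268569023, 35136987, 3465631, 2148538345, 17097470, 967343, 969433, 4275175,
     1610744559, 35666905], [845239, 35662846, 4394671, 75558078, 447927, 136324029, 268448575,
     75560777, 662526, 75556718, 75559143, 3678687, 35783407, 327406, 268446959, 34618587,
     4273150, 3281375, 34618203, 75556151, 1610621375, 16792055, 3280479, 135275711, 845273,
     326839, 326455, 16911551, 16911167, 2148533753], [325479, 443902, 16910191, 35660223,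
     4270583, 3160287, 445047, 659903, 16791103, 75556185, 539511, 16789999, 326873, 324399,
     326489, 657903, 322430, 4268527, 442991, 320887, 537839, 537455, 134903, 532863, 135551,
     16345, 133823, 132847, 14463, 9663]], [[176, 153, 43, 172, 62, 928, 905, 818, 795, 2257,
     2147, 924, 814, 2276, 2253, 1073, 2166, 1171, 2143, 3009, 1069, 2899, 1190, 1167, 3028,
     1825, 2918, 1923, 2895, 1844], [3192, 1821, 1942, 3290, 3173, 12329, 3271, 12450, 12427,
     3944, 12348, 4042, 12446, 3925, 13104, 13081, 13202, 14433, 13100, 14531, 13198, 32890,
     13457, 14429, 14550, 13347, 32871, 15185, 13476, 13453, 33752], [15204, 13343, 33642,
     14209, 15181, 15302, 33733, 33623, 15576, 33897, 14095, 34018, 33995, 16952, 16328, 16933,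
     16218, 34649, 17031, 34770, 34766, 16679, 19033, 45176, 45157, 45255, 17970, 18802, 45928,
     18779], [18076, 46026, 17966, 17826, 45909, 18798, 17724, 46281, 20051, 46171, 20180,
     29336, 46300, 29226, 46190, 19907, 29317, 46923, 19805, 19926, 47052, 29082, 46942, 31330,
     31307, 31436, 30256, 31088, 30354, 31326, 49757], [31065, 49878, 31186, 49617, 30252,
     49507, 31084, 30350, 30089, 49636, 31182, 30002, 49613, 29979, 49526, 49503, 32337, 29998,
     50904, 32356, 50794, 32333, 32454, 50885, 32193, 50775, 32083, 50552, 32212, 50650],
     [32102, 50631, 62145, 62035, 62164, 62054, 67625, 61793, 67746, 62031, 67723, 61891, 67644,
     61812, 61789, 61910, 68400, 68377, 68498, 63080, 68396, 63178, 68494, 63061, 68753, 68643,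
     62936, 68772, 62826, 68749, 62917], [68662, 68639, 62807, 69505, 69395, 69524, 69414,
     69391, 80032, 80009, 79922, 98353, 79899, 98451, 80028, 79918, 98349, 98470, 80784, 80674,
     99105, 80651, 80780, 99101, 80929, 100570, 100453, 99496, 100551, 101224, 100138]]),
     (11711700, 9909900, [[34360336857, 268756158, 268755774, 4916926, 34925402, 76084361,
     1610748343, 268878425, 76080302, 206158443465, 968182, 268969214, 3684567, 17221449,
     1611145689, 35785191, 967102, 36184537, 4396599, 34619283, 663358, 75559975, 3679519,
     75678014], [2148538553, 135279151, 135281241, 848713, 448702, 16914046, 135277182,
     268449689, 2148537193, 4303372633, 35664047, 4393519, 268568281, 268447807, 3279575,
     323510, 326254, 3158927, 3156958, 658735, 446161, 844121, 16790199, 75555281], [321454,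
     323544, 658103, 3155415, 16788199, 445081, 538743, 444105, 323631, 321662, 538569,
     16786174, 656047, 533943, 4268761, 320921, 136631, 136665, 14183, 132606, 133551, 15193,
     11518, 11134]], [[169, 59, 188, 944, 921, 811, 2273, 940, 2163, 830, 2292, 2269, 1187,
     2159, 3025, 2915, 1085, 1206, 3044, 1183, 3021, 1841, 2934, 1939], [2911, 1837, 1958, 3306,
     3189, 12345, 3287, 12466, 12443, 4058, 4039, 14449, 14547, 13214, 15299, 17047, 19170,
     18092, 17982, 17842, 17819, 49773, 30268, 50647], [62047, 67739, 61805, 68393, 68514,
     68491, 68788, 62842, 62823, 69521, 69411, 69517, 80025, 79915, 79934, 98365, 80800, 80777,
     99121, 80796, 99117, 100469, 100567, 81062]]),
     (14414400, 7207200, [[274953985150, 55784667, 4307765807, 78832207, 20065503, 4711166,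
     36315887, 34922451, 168084345, 4578095, 3464151, 75687294, 34359811199, 457982, 39912063,
     35964223, 4791151, 274877910655, 975471, 21039095, 76072375, 4402799, 135791551,
     17246995903, 136322685, 34746075, 1610619895, 7407327, 8598358207, 4572527, 17092271],
     [206158431615, 454327, 34915803, 1610620031, 454975, 17307327, 75553591, 452975, 842713,
     75552615, 838654, 4267951, 16917487, 452271, 3457503, 668031, 837111, 75551919, 75551535,
     75553625, 147454, 268440831, 16784831, 836031, 1610613247, 4263359, 318327, 532287, 144831,
     4261503, 7103, 1535]], [[41, 162, 139, 60, 158, 816, 793, 914, 2145, 812, 2243, 910, 2164,
     1169, 2141, 2262, 1059, 1188, 1165, 1078, 2916, 1921, 2893, 3014, 1811], [1940, 1830, 3178,
     12425, 12338, 12315, 4040, 3930, 12334, 3911, 13196, 13086, 14438, 32869, 15171, 33906,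
     15445, 16677, 16775, 31051, 30098, 49501, 32342, 50538, 50629], [62033, 62150, 67740,
     61798, 68492, 63047, 68739, 62824, 62922, 68637, 69510, 79920, 79897, 80018, 98339, 98468,
     80014, 98445, 80672, 98358, 80649, 98335, 99091, 80668, 80911]]),
     (13213200, 8408400, [[1099622891803, 21424359, 17251194991, 80268753, 5032375, 21497719,
     79745854, 1614809591, 139463927, 4863705, 79744238, 39848439, 4341175, 34359746487,
     1614808639, 5032409, 20979319, 139461871, 4512999], [4726575, 4341209, 79743321, 4337150,
     20977263, 4339319, 79742617, 34359744639, 4508023, 20972535, 34359739839, 20972671,
     7340767, 4505967, 4720375, 4202471, 4201391, 4197879, 4195823]], [[170, 53, 151, 824, 922,
     805, 2153, 2274, 903, 2251, 1200, 2172, 1177, 1067, 2928, 2905, 1196, 1086, 2924, 1929,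
     1842, 1819, 3171, 1948, 3277, 12456, 12346, 12437, 12327], [13208, 15476, 33895, 16950,
     49755, 29989, 50550, 50527, 62060, 67752, 62158, 61897, 67623, 68485, 63055, 62915, 62813,
     68766, 62934, 69424, 69401, 69420, 69518, 80026, 98476, 99099, 99377, 80923, 81052]]),
     (15315300, 6306300, [[549865972027, 275856223, 1610938343, 17747929, 36191223, 76085095,
     34359938687, 76084399, 75685118, 851191, 17435519, 136329981, 969199, 1610747519, 21046527,
     17100399, 4579823, 35787263], [35786367, 135281279, 848751, 4276079, 4303372671, 4396671,
     75560047, 135276479, 446199, 844159, 446847, 327641, 445119, 538607, 16790271, 4268799,
     534015, 136703]], [[160, 137, 50, 27, 156, 46, 912, 802, 779, 2241, 908, 2131, 798, 2260,
     1057, 2150, 1155, 2127, 1053, 1174], [3012, 1809, 2902, 3176, 3274, 3909, 31424, 30217,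
     31068, 62019, 67609, 67730, 61796, 67726, 63064, 68627, 68623, 69508, 69398, 80016]]),
     (10810800, 10810800, [[4791463, 35791294, 268748760, 3460054, 34916298, 17307959,
     8598356775, 3675079, 669886, 17089902, 842641, 842777, 665959, 136315829, 452937, 838616,
     4266031, 145326, 147416, 268440409, 16780734, 16782903, 1610613209, 141879, 312558, 528559,
     530649, 524663, 7065, 1463]], [[171, 190, 825, 923, 2275, 942, 1201, 2173, 2294, 2271,
     2929, 3027, 1087, 1953, 2925, 3046, 3023, 1843, 1972, 3320, 1949, 3191, 4072, 15222, 16951,
     61921, 63079, 98477, 99233]]),
     (12312300, 9309300, [[21631039, 39117339, 34360272247, 139469999, 5039561, 272639351,
     4639166, 21105455, 1099511701979, 4639335, 34359754649, 4854191, 34359750590, 4734183,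
     20983422, 2152727161, 38807195, 7348895, 4514095, 4210599, 4331191, 4329839, 4331225,
     4208751, 4203951, 4204151, 4203071]], [[184, 165, 55, 936, 826, 917, 2265, 807, 2155, 2284,
     1081, 1202, 2174, 3040, 1179, 2907, 1198, 1833, 1954, 2926, 1931], [3185, 3302, 3956,
     32993, 13191, 14539, 13488, 13465, 14130, 17062, 45917, 49648, 32114, 61922, 61918, 63171,
     68761, 62819, 62948, 62925, 68670]]),
     (14714700, 6906900, [[1101122566363, 76151897, 35327707, 35733431, 17381111, 17164975,
     1610811119, 729086, 35849967, 268513135, 135341887, 393015, 35726783, 511607, 16857535,
     16856559, 75620727, 724463, 16976127, 509551, 16855679, 723583, 599423, 202111, 74239]],
     [[145, 35, 164, 141, 54, 31, 897, 787, 916, 2264, 806, 2154, 783, 2245, 2135, 3016, 1061,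
     2906, 12321, 12419, 12340, 3913, 30221, 32090, 67715, 68388, 62795, 79887, 80662]]),
     (12012000, 9609600, [[3354911, 274877973103, 8598421735, 2148607289, 1610681278,
     17247060441, 167838705, 268504935, 17156809, 35719150, 17371865, 732825, 902553, 382759,
     135332087, 597175, 16847479, 208439, 596825, 206383, 70767, 66039]], [[163, 61, 182, 159,
     817, 915, 813, 934, 2282, 911, 2165, 2263, 1189, 2936, 3179, 3308, 4064, 12468, 101321]]),
     (13813800, 7807800, [[3528863, 4303446489, 17158575, 16984951, 17158775, 519735, 3353183,
     906415, 75619281, 75615222, 136381693, 135332855, 384119, 210239, 383039, 595887, 382063,
     591295]], [[49, 147, 45, 143, 801, 899, 820, 2168, 2266, 2149, 1082, 13075]]),
     (15615600, 6006000, [[75754201, 135339711, 1610684399, 518903, 35723247, 75618095, 732863,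
     268507007, 384887, 75616495, 596863, 73663]], [[33, 131, 52, 29, 785, 2152, 781, 2133,
     2904, 1799, 79885]]),
     (10510500, 11111100, [[4729241, 4207806, 4204185]], [[823, 2171, 2300, 1849, 1970, 2942]]),
     (11411400, 10210200, [[4337967, 4339353]], [[938, 2290]]),
     (10210200, 11411400, [[268508790, 906377]], [[179, 175]]),
     (12162150, 9459450, [[2199040038617]], [[665, 574]]),
     (16816800, 4804800, [[79742655]], [[40]]),
     (13063050, 8558550, [[2199023392063]], [[651]]),
     (12462450, 9159150, [[2199023334575]], [[659]]),
     (10660650, 10960950, [[2199023453897]], [[573]])]"

definition mask_groups :: "(num \<times> num \<times> num list list \<times> num list list) list" where
  "mask_groups = map (\<lambda>(r, s, As, Bs). (num_of_nat r, num_of_nat s,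
     map (map num_of_nat) As, map (map num_of_nat) Bs)) masks"

schematic_goal mask_groups_eq: "mask_groups = ?gs"
  unfolding mask_groups_def masks_def list.map prod.case num_of_nat_numeral_eq num_of_nat_1 by (rule refl)

schematic_goal weights_a_eq: "weights 21621600 pool_a = ?ps"
  unfolding pool_a_def by simp

schematic_goal weights_b_eq: "weights 21621600 pool_b = ?ps"
  unfolding pool_b_def by simp

text \<open>Checks the table itself: all masks have the stated reciprocal sums, and the second lists
  are sorted by sum of squares.\<close>

lemma valid_masks: "valid (num_of_nat 21621600) (weights 21621600 pool_a) (weights 21621600 pool_b) mask_groups"
  unfolding mask_groups_eq weights_a_eq weights_b_eq num_of_nat_numeral_eq by code_simp

abbreviation groups :: "(block list \<times> block list) list" where
  "groups \<equiv> evaluate (weights 21621600 pool_a) (weights 21621600 pool_b) mask_groups"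

schematic_goal blank_10_eq: "blank 10 = ?t"
  by (simp add: numeral_eq_Suc)

schematic_goal starts_0: "map (\<lambda>j. num_of_nat (13660 + 1024 * j)) [2..<17] = ?cs"
  by simp

text \<open>Sixty windows of length 1024, in four batches of fifteen. The first, at j = 2, starts at
  13660 + 2048 = 15708.\<close>

lemma covers_0:
  "covers (blank 10) (num_of_nat 1024) groups (map (\<lambda>j. num_of_nat (13660 + 1024 * j)) [2..<17])"
  unfolding starts_0 mask_groups_eq weights_a_eq weights_b_eq blank_10_eq num_of_nat_numeral_eq
  by code_simp

schematic_goal starts_1: "map (\<lambda>j. num_of_nat (13660 + 1024 * j)) [17..<32] = ?cs"
  by simp

lemma covers_1:
  "covers (blank 10) (num_of_nat 1024) groups (map (\<lambda>j. num_of_nat (13660 + 1024 * j)) [17..<32])"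
  unfolding starts_1 mask_groups_eq weights_a_eq weights_b_eq blank_10_eq num_of_nat_numeral_eq
  by code_simp

schematic_goal starts_2: "map (\<lambda>j. num_of_nat (13660 + 1024 * j)) [32..<47] = ?cs"
  by simp

lemma covers_2:
  "covers (blank 10) (num_of_nat 1024) groups (map (\<lambda>j. num_of_nat (13660 + 1024 * j)) [32..<47])"
  unfolding starts_2 mask_groups_eq weights_a_eq weights_b_eq blank_10_eq num_of_nat_numeral_eq
  by code_simp

schematic_goal starts_3: "map (\<lambda>j. num_of_nat (13660 + 1024 * j)) [47..<62] = ?cs"
  by simp

lemma covers_3:
  "covers (blank 10) (num_of_nat 1024) groups (map (\<lambda>j. num_of_nat (13660 + 1024 * j)) [47..<62])"
  unfolding starts_3 mask_groups_eq weights_a_eq weights_b_eq blank_10_eq num_of_nat_numeral_eq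
  by code_simp

lemma representable_base:
  assumes "15707 < m" "m \<le> 4 * 15707 + 13946"
  shows "representable 6 m"
proof -
  let ?L = "21621600 :: nat"
  \<comment> \<open>\<open>P n\<close> says that some subset of the two pools has reciprocal sum 1
    and sum of squares \<open>n\<close>.\<close>
  define P where "P n \<longleftrightarrow> (?L, nat_of_num n) \<in> subset_sums (weights ?L (pool_a @ pool_b))" for n
  define n where "n = nat m"
  define j where "j = (n - 13660) div 1024"
  \<comment> \<open>The upper bound is 4 * 15707 + 13946 = 76774, below 13660 + 1024 * 62 = 77148,
    where the last window ends.\<close>
  have n: "13660 + 1024 * j \<le> n" "n < 13660 + 1024 * j + 1024" "2 \<le> j" "j < 62"
    using assms unfolding n_def j_def by linarith+
  have blocks: "\<forall>(As, Bs)\<in>set groups. \<forall>A\<in>set As. \<forall>B\<in>set Bs. block_ok P A B"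
    using block_ok_evaluate[OF valid_masks]
    by (simp add: P_def[abs_def] weights_append num_of_nat_inverse del: num_of_nat_numeral_eq)
  let ?c = "num_of_nat (13660 + 1024 * j)"
  have cover: "P (num_of_nat n)"
    if "covers (blank 10) (num_of_nat 1024) groups (map (\<lambda>j. num_of_nat (13660 + 1024 * j)) [x..<y])"
      "x \<le> j" "j < y" for x y
  proof (rule covers_imp[OF that(1) blocks])
    show "?c \<in> set (map (\<lambda>j. num_of_nat (13660 + 1024 * j)) [x..<y])"
      using that(2,3) by auto
    show "?c \<le> num_of_nat n" "num_of_nat n < ?c + num_of_nat 1024"
      using n by (simp_all add: less_eq_num_def less_num_def nat_of_num_add num_of_nat_inverse del: num_of_nat_numeral_eq)
  qed (simp_all add: num_of_nat_inverse del: num_of_nat_numeral_eq)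
  consider "j < 17" | "17 \<le> j" "j < 32" | "32 \<le> j" "j < 47" | "47 \<le> j"
    by linarith
  then have "P (num_of_nat n)"
    using cover[OF covers_0] cover[OF covers_1] cover[OF covers_2] cover[OF covers_3] n(3,4)
    by cases simp_all
  then have "(?L, n) \<in> subset_sums (weights ?L (pool_a @ pool_b))"
    using n by (simp add: P_def num_of_nat_inverse)
  then have "representable 6 (int n)"
    by (rule representable_of_subset_sums[rotated 3]) (simp_all add: pool_a_def pool_b_def)
  then show ?thesis
    using assms by (simp add: n_def)
qed

theorem theorem3:
  shows "\<not> representable 6 15707 \<and> (\<forall>m :: int. m > 15707 \<longrightarrow> representable 6 m)"
  using not_representable_15707 representable_above[of 15707] representable_base by simp

end
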